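(* Let $f:\mathbb{Z}_+\to\mathbb{R}$ be an arithmetic function, let $(x_p)_{p\in\mathbb{P}}$ be a sequence of real numbers and let $(y_p)_{p\in\mathbb{P}}$ be a sequence of nonzero real numbers, both indexed by the set $\mathbb{P}$ of primes. The following conditions are equivalent: (a) $f$ is L-additive with an associated function $h_f$ satisfying $h_f(p)=y_p$ for all $p\in\mathbb{P}$, and $f(p)=x_p$ for all $p\in\mathbb{P}$; (b) for all $n\in\mathbb{Z}_+$, $$f(n)=\Big(\sum_{p\in\mathbb{P}}\nu_p(n)\frac{x_p}{y_p}\Big)\prod_{p\in\mathbb{P}}y_p^{\nu_p(n)}.$$
   Context: For $n\in\mathbb{Z}_+$ and a prime $p$, $\nu_p(n)$ denotes the exponent of $p$ in the prime factorization of $n$, so $n=\prod_{p\in\mathbb{P}}p^{\nu_p(n)}$. An arithmetic function $h:\mathbb{Z}_+\to\mathbb{R}$ is completely multiplicative if $h(1)=1$ and $h(mn)=h(m)h(n)$ for all $m,n\in\mathbb{Z}_+$. An arithmetic function $f$ is L-additive (Leibniz-additive) if there is a nonzero-valued completely multiplicative function $h_f$ such that $f(mn)=f(m)h_f(n)+f(n)h_f(m)$ for all $m,n\in\mathbb{Z}_+$. *)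

theory Defs
  imports Complex_Main "HOL-Computational_Algebra.Primes"
begin

text \<open>
  An arithmetic function on the positive integers is a function on \<^typ>\<open>nat\<close> of which only the
  values at positive arguments are constrained; the value at 0 is irrelevant.
\<close>

definition completely_multiplicative :: "(nat \<Rightarrow> real) \<Rightarrow> bool" where
  "completely_multiplicative h \<longleftrightarrow>
     h 1 = 1 \<and> (\<forall>m n. 0 < m \<longrightarrow> 0 < n \<longrightarrow> h (m * n) = h m * h n)"

text \<open>
  The associated function is an explicit argument because it need not be determined by \<open>f\<close>
  (for \<open>f = 0\<close> every choice is admissible).
\<close>

definition L_additive_with :: "(nat \<Rightarrow> real) \<Rightarrow> (nat \<Rightarrow> real) \<Rightarrow> bool" where
  "L_additive_with f h \<longleftrightarrow>
     completely_multiplicative h \<and> (\<forall>n>0. h n \<noteq> 0) \<and>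
     (\<forall>m n. 0 < m \<longrightarrow> 0 < n \<longrightarrow> f (m * n) = f m * h n + f n * h m)"

text \<open>
  Sums and products over the infinite set of primes are written with the library's \<^const>\<open>sum'\<close>
  and \<^const>\<open>prod'\<close>, which drop neutral terms first. (Plain \<^const>\<open>sum\<close> and \<^const>\<open>prod\<close> over an
  infinite set are 0 and 1.) For \<open>n > 0\<close> only the prime divisors of \<open>n\<close> can contribute.
\<close>

end

theory Submission
  imports Defs
begin

text \<open>
  Write \<open>S n\<close> and \<open>P n\<close> for the sum and the product in the formula. \<open>S\<close> turns products
  into sums and \<open>P\<close> is completely multiplicative and nowhere zero, so \<open>S * P\<close> satisfies the
  Leibniz rule with \<open>h = P\<close>. Conversely, the Leibniz rule determines \<open>f\<close> from its values and
  those of \<open>h\<close> at the primes, by peeling off one prime factor at a time.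
\<close>

definition add_ext :: "(nat \<Rightarrow> real) \<Rightarrow> nat \<Rightarrow> real" where
  "add_ext a n = sum' (\<lambda>p. real (multiplicity p n) * a p) {p. prime p}"

definition mult_ext :: "(nat \<Rightarrow> real) \<Rightarrow> nat \<Rightarrow> real" where
  "mult_ext y n = prod' (\<lambda>p. y p ^ multiplicity p n) {p. prime p}"

text \<open>Supplies the finite supports under which \<open>sum'\<close> and \<open>prod'\<close>
  split over pointwise sums and products: primes of positive multiplicity divide \<open>n\<close>,
  and a positive \<open>n\<close> has finitely many divisors.\<close>

lemma finite_multiplicity_support:
  fixes n :: nat
  assumes "n > 0"
  shows "finite {p. prime p \<and> multiplicity p n > 0}"
proof (rule finite_subset)
  show "{p. prime p \<and> multiplicity p n > 0} \<subseteq> {p. p dvd n}"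
    by (metis (mono_tags, lifting) mem_Collect_eq subsetI less_irrefl not_dvd_imp_multiplicity_0)
qed (use assms in simp)

lemma add_ext_mult:
  assumes "m > 0" "n > 0"
  shows "add_ext a (m * n) = add_ext a m + add_ext a n"
proof -
  have *: "finite {p \<in> {p. prime p}. real (multiplicity p k) * a p \<noteq> 0}" if "k > 0" for k
    by (rule finite_subset[OF _ finite_multiplicity_support[OF that]]) auto
  have "add_ext a (m * n) =
      sum' (\<lambda>p. real (multiplicity p m) * a p + real (multiplicity p n) * a p) {p. prime p}"
    unfolding add_ext_def using assms
    by (intro sum.cong')
       (simp_all add: prime_elem_multiplicity_mult_distrib distrib_right)
  also have "\<dots> = add_ext a m + add_ext a n"
    unfolding add_ext_def using assms by (intro sum.distrib' *)
  finally show ?thesis .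
qed

lemma mult_ext_mult:
  assumes "m > 0" "n > 0"
  shows "mult_ext y (m * n) = mult_ext y m * mult_ext y n"
proof -
  \<comment> \<open>A power different from 1 has a positive exponent.\<close>
  have *: "finite {p \<in> {p. prime p}. y p ^ multiplicity p k \<noteq> 1}" if "k > 0" for k
    by (rule finite_subset[OF _ finite_multiplicity_support[OF that]])
       (auto intro!: gr0I)
  have "mult_ext y (m * n) =
      prod' (\<lambda>p. y p ^ multiplicity p m * y p ^ multiplicity p n) {p. prime p}"
    unfolding mult_ext_def using assms
    by (intro prod.cong')
       (simp_all add: prime_elem_multiplicity_mult_distrib power_add)
  also have "\<dots> = mult_ext y m * mult_ext y n"
    unfolding mult_ext_def using assms by (intro prod.distrib' *)
  finally show ?thesis .
qed

text \<open>Every multiplicity in 1 is 0, so all terms are neutral. The argument is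
  \<open>Suc 0\<close> because the simplifier rewrites 1 to it.\<close>

lemma add_ext_1 [simp]: "add_ext a (Suc 0) = 0"
  by (simp add: add_ext_def sum.G_def)

lemma mult_ext_1 [simp]: "mult_ext y (Suc 0) = 1"
  by (simp add: mult_ext_def prod.G_def)

lemma add_ext_prime:
  assumes "prime q"
  shows "add_ext a q = a q"
proof -
  have "add_ext a q = sum' (\<lambda>p. real (multiplicity p q) * a p) {q}"
    unfolding add_ext_def using assms
    \<comment> \<open>A prime other than \<open>q\<close> has multiplicity 0 in
      \<open>q\<close>.\<close>
    by (intro sum.mono_neutral_right') (auto simp: prime_multiplicity_other)
  also have "\<dots> = a q"
    using assms by (simp add: multiplicity_self)
  finally show ?thesis .
qed

lemma mult_ext_prime:
  assumes "prime q"
  shows "mult_ext y q = y q"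
proof -
  have "mult_ext y q = prod' (\<lambda>p. y p ^ multiplicity p q) {q}"
    unfolding mult_ext_def using assms
    by (intro prod.mono_neutral_right') (auto simp: prime_multiplicity_other)
  also have "\<dots> = y q"
    using assms by (simp add: multiplicity_self)
  finally show ?thesis .
qed

text \<open>\<open>prod'\<close> is either a finite product of powers of nonzero numbers or, on
  infinite support, the default value 1. This covers every \<open>n\<close>, including 0.\<close>

lemma mult_ext_nonzero:
  assumes "\<And>p. prime p \<Longrightarrow> y p \<noteq> 0"
  shows "mult_ext y n \<noteq> 0"
  using assms by (auto simp: mult_ext_def prod.G_def)

lemma L_additive_with_ext:
  assumes "\<And>p. prime p \<Longrightarrow> y p \<noteq> 0"
    and "\<And>n. n > 0 \<Longrightarrow> f n = add_ext a n * mult_ext y n"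
  shows "L_additive_with f (mult_ext y)"
  unfolding L_additive_with_def completely_multiplicative_def
proof (intro conjI allI impI)
  fix m n :: nat
  assume pos: "0 < m" "0 < n"
  then show "mult_ext y (m * n) = mult_ext y m * mult_ext y n"
    by (rule mult_ext_mult)
  show "f (m * n) = f m * mult_ext y n + f n * mult_ext y m"
    using pos by (simp add: assms(2) add_ext_mult mult_ext_mult algebra_simps)
qed (simp_all add: assms(1) mult_ext_nonzero)

lemma completely_multiplicative_eq_mult_ext:
  assumes h: "completely_multiplicative h"
    and y: "\<And>p. prime p \<Longrightarrow> h p = y p"
    and "n > 0"
  shows "h n = mult_ext y n"
  using \<open>n > 0\<close>
proof (induction n rule: prime_divisors_induct)
  \<comment> \<open>The induction hypothesis is guarded by \<open>n > 0\<close>, which follows from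
    positivity of \<open>p * n\<close>. The remaining cases are 0, excluded by positivity, and the
    unit 1.\<close>
  case (factor p n)
  then have "p > 0" "n > 0"
    by (auto simp: prime_gt_0_nat)
  with factor h y show ?case
    by (simp add: completely_multiplicative_def mult_ext_mult mult_ext_prime)
qed (use h in \<open>auto simp: completely_multiplicative_def\<close>)

text \<open>The Leibniz rule at \<open>m = n = 1\<close> reads \<open>f 1 = 2 * f 1\<close>. This is
  the base case of the induction that determines \<open>f\<close>.\<close>

lemma L_additive_with_one:
  assumes "L_additive_with f h"
  shows "f 1 = 0"
proof -
  have "h 1 = 1"
    using assms by (simp add: L_additive_with_def completely_multiplicative_def)
  moreover have "f (m * n) = f m * h n + f n * h m" if "m > 0" "n > 0" for m n
    using assms that by (simp add: L_additive_with_def)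
  from this[of 1 1] have "f 1 = f 1 * h 1 + f 1 * h 1"
    by simp
  ultimately show ?thesis
    by simp
qed

text \<open>With S and P the two factors on the right, peeling off \<open>p\<close> gives x_p P(n) +
  S(n) P(n) y_p = (x_p / y_p + S(n)) y_p P(n), which is S(p n) P(p n). This is where the quotients
  x_p / y_p come from.\<close>

lemma L_additive_with_eq_ext:
  assumes f: "L_additive_with f h"
    and y: "\<And>p. prime p \<Longrightarrow> h p = y p"
    and x: "\<And>p. prime p \<Longrightarrow> f p = x p"
    and "n > 0"
  shows "f n = add_ext (\<lambda>p. x p / y p) n * mult_ext y n"
  using \<open>n > 0\<close>
proof (induction n rule: prime_divisors_induct)
  case (factor p n)
  then have pos: "p > 0" "n > 0"
    by (auto simp: prime_gt_0_nat)
  have "h n = mult_ext y n"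
    using completely_multiplicative_eq_mult_ext[OF _ y] f pos
    by (auto simp: L_additive_with_def)
  \<comment> \<open>Here \<open>y p\<close> is a value of \<open>h\<close>, which vanishes nowhere
    on positive arguments.\<close>
  moreover have "y p \<noteq> 0"
    using f y[of p] pos factor by (metis L_additive_with_def)
  moreover have "f (p * n) = f p * h n + f n * h p"
    using f pos by (simp add: L_additive_with_def)
  ultimately show ?case
    using factor pos x y
    by (simp add: add_ext_mult mult_ext_mult add_ext_prime mult_ext_prime field_simps)
qed (use L_additive_with_one[OF f] in auto)

theorem theorem3:
  fixes f x y :: "nat \<Rightarrow> real"
  assumes "\<And>p. prime p \<Longrightarrow> y p \<noteq> 0"
  shows "((\<exists>h. L_additive_with f h \<and> (\<forall>p. prime p \<longrightarrow> h p = y p)) \<and>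
          (\<forall>p. prime p \<longrightarrow> f p = x p))
     \<longleftrightarrow>
         (\<forall>n>0. f n = sum' (\<lambda>p. real (multiplicity p n) * (x p / y p)) {p. prime p} *
                     prod' (\<lambda>p. y p ^ multiplicity p n) {p. prime p})"
    (is "?L \<longleftrightarrow> ?R")
proof
  assume ?L
  then show ?R
    using L_additive_with_eq_ext[of f _ y x] by (auto simp: add_ext_def mult_ext_def)
next
  assume ?R
  then have f: "f n = add_ext (\<lambda>p. x p / y p) n * mult_ext y n" if "n > 0" for n
    using that by (simp add: add_ext_def mult_ext_def)
  \<comment> \<open>At a prime the formula collapses to (x_p / y_p) y_p.\<close>
  have "f p = x p" if "prime p" for p
    using that assms f[of p] by (simp add: prime_gt_0_nat add_ext_prime mult_ext_prime)
  moreover have "L_additive_with f (mult_ext y)"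
    using assms f by (rule L_additive_with_ext)
  ultimately show ?L
    using mult_ext_prime by blast
qed

end
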